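(* For any integer $m\ge2$, let $\hat\Theta_m$ be the set of all $\theta\in\mathbb{N}$ such that for every strict ranking pattern $\boldsymbol{\sigma}\in\hat\Sigma^{(m)}$ there exists a voting situation $\mathcal{N}^{(m)}$ that is $q$-concordant with $\boldsymbol{\sigma}$ and has total number of voters $n(\mathcal{N}^{(m)})=\theta$. Let $$z_m:=17\cdot m\cdot m!,\qquad \bar\theta_m:=\prod_{h=2}^{m}\left[h\cdot z_m^{h-1}-\frac{h(h-1)}{2}\right].$$ Then: (i) the integer $\bar\theta_m$ belongs to $\hat\Theta_m$; (ii) each integer $\theta\ge\bar\theta_m\cdot m!$ belongs to $\hat\Theta_m$.
   Context: $\mathbb{N}=\{1,2,\ldots\}$. Let $[k]=\{1,\dots,k\}$ (with $[0]=\emptyset$), $[m]$ the set of candidates, and $\Pi_m$ the set of permutations $(j_1,\ldots,j_m)$ of the elements of $[m]$. Ranking functions and patterns. For $A\subseteq[m]$, a map $\sigma(A,\cdot):A\to\{1,\ldots,|A|\}$ is a ranking function if for each $i\in A$, $\sigma(A,i)=1+\left|\{j\in A:\sigma(A,j)\le\sigma(A,i)-1\}\right|$. It is strict if it is injective (hence a bijection onto $\{1,\ldots,|A|\}$), and weak otherwise. A ranking pattern over $[m]$ ($m\ge2$) is a family $\boldsymbol{\sigma}=\{\sigma(A,\cdot):A\subseteq[m],\,|A|\ge2\}$ of ranking functions; it is strict if it contains no weak ranking function. $\hat\Sigma^{(m)}$ denotes the set of all strict ranking patterns over $[m]$. Voting situations. A voting situation is a family $\mathcal{N}^{(m)}=\{N^{(m)}(j_1,\ldots,j_m):(j_1,\ldots,j_m)\in\Pi_m\}$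 of non-negative integers, where $N^{(m)}(j_1,\ldots,j_m)$ is the number of voters (in a finite nonempty set of voters) whose preference ranking, from most to least preferred, is $(j_1,\ldots,j_m)$. The total number of voters is $n(\mathcal{N}^{(m)})=\sum_{(j_1,\ldots,j_m)\in\Pi_m}N^{(m)}(j_1,\ldots,j_m)$. For $A\subseteq[m]$ and $i\in A$, $n_i(A)$ is the number of votes obtained by $i$ when $A$ is the set of competing candidates, i.e. the sum of $N^{(m)}(j_1,\ldots,j_m)$ over all $(j_1,\ldots,j_m)\in\Pi_m$ in which $i$ occupies an earlier position than every other element of $A$. Concordance. $\boldsymbol{\sigma}$ and $\mathcal{N}^{(m)}$ are $q$-concordant if for any $A\subseteq[m]$ and $i,j\in A$ with $i\ne j$: $\sigma(A,i)<\sigma(A,j)\Leftrightarrow n_i(A)>n_j(A)$, and $\sigma(A,i)=\sigma(A,j)\Leftrightarrow n_i(A)=n_j(A)$. *)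

theory Defs
  imports Complex_Main "HOL-Combinatorics.Multiset_Permutations"
begin

text \<open>Candidates are the natural numbers \<open>1, \<dots>, m\<close>. A family indexed by subsets of the
  candidates (or by preference rankings) is a total function of which only the values on the
  index set matter; no condition is imposed elsewhere.\<close>

definition ranking_function :: "nat set \<Rightarrow> (nat \<Rightarrow> nat) \<Rightarrow> bool" where
  "ranking_function A f \<longleftrightarrow>
     f \<in> A \<rightarrow> {1..card A} \<and> (\<forall>i\<in>A. f i = 1 + card {j\<in>A. f j \<le> f i - 1})"

definition strict_ranking_function :: "nat set \<Rightarrow> (nat \<Rightarrow> nat) \<Rightarrow> bool" where
  "strict_ranking_function A f \<longleftrightarrow> ranking_function A f \<and> inj_on f A"

definition ranking_pattern :: "nat \<Rightarrow> (nat set \<Rightarrow> nat \<Rightarrow> nat) \<Rightarrow> bool" where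
  "ranking_pattern m \<sigma> \<longleftrightarrow> (\<forall>A. A \<subseteq> {1..m} \<and> card A \<ge> 2 \<longrightarrow> ranking_function A (\<sigma> A))"

definition strict_ranking_patterns :: "nat \<Rightarrow> (nat set \<Rightarrow> nat \<Rightarrow> nat) set" where
  "strict_ranking_patterns m =
     {\<sigma>. ranking_pattern m \<sigma> \<and>
          (\<forall>A. A \<subseteq> {1..m} \<and> card A \<ge> 2 \<longrightarrow> strict_ranking_function A (\<sigma> A))}"

text \<open>A preference ranking is an element of \<^term>\<open>permutations_of_set {1..m}\<close>, a list
  running from the most to the least preferred candidate; \<open>N js\<close> is the number of voters
  with preference ranking \<open>js\<close>.\<close>

definition num_voters :: "nat \<Rightarrow> (nat list \<Rightarrow> nat) \<Rightarrow> nat" where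
  "num_voters m N = (\<Sum>js\<in>permutations_of_set {1..m}. N js)"

text \<open>Non-negativity is built into the type; what remains is that there is at least one voter.\<close>

definition voting_situation :: "nat \<Rightarrow> (nat list \<Rightarrow> nat) \<Rightarrow> bool" where
  "voting_situation m N \<longleftrightarrow> num_voters m N > 0"

definition occurs_before :: "'a list \<Rightarrow> 'a \<Rightarrow> 'a \<Rightarrow> bool" where
  "occurs_before js i j \<longleftrightarrow> (\<exists>a b. a < b \<and> b < length js \<and> js ! a = i \<and> js ! b = j)"

definition votes :: "nat \<Rightarrow> (nat list \<Rightarrow> nat) \<Rightarrow> nat set \<Rightarrow> nat \<Rightarrow> nat" where
  "votes m N A i =
     (\<Sum>js \<in> {js \<in> permutations_of_set {1..m}. \<forall>j\<in>A - {i}. occurs_before js i j}. N js)"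

definition q_concordant :: "nat \<Rightarrow> (nat set \<Rightarrow> nat \<Rightarrow> nat) \<Rightarrow> (nat list \<Rightarrow> nat) \<Rightarrow> bool" where
  "q_concordant m \<sigma> N \<longleftrightarrow>
     (\<forall>A i j. A \<subseteq> {1..m} \<and> i \<in> A \<and> j \<in> A \<and> i \<noteq> j \<longrightarrow>
        (\<sigma> A i < \<sigma> A j \<longleftrightarrow> votes m N A i > votes m N A j) \<and>
        (\<sigma> A i = \<sigma> A j \<longleftrightarrow> votes m N A i = votes m N A j))"

definition Theta_hat :: "nat \<Rightarrow> int set" where
  "Theta_hat m =
     {\<theta>. \<theta> \<ge> 1 \<and> (\<forall>\<sigma>\<in>strict_ranking_patterns m.
        \<exists>N. voting_situation m N \<and> q_concordant m \<sigma> N \<and> int (num_voters m N) = \<theta>)}"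

definition z_num :: "nat \<Rightarrow> int" where
  "z_num m = 17 * int m * fact m"

text \<open>Integers avoid truncated subtraction; the division is exact since \<open>h * (h - 1)\<close> is even.\<close>

definition theta_bar :: "nat \<Rightarrow> int" where
  "theta_bar m = (\<Prod>h=2..m. int h * z_num m ^ (h - 1) - (int h * (int h - 1)) div 2)"

end

theory Submission
  imports Defs
begin

text \<open>Let every voter build a ranking by successively removing the winner from the set \<open>B\<close> of
  candidates that remain, and let \<open>i \<in> B\<close> be removed with integer weight
  \<open>z ^ (card B - 1) - (\<sigma> B i - 1)\<close>. The number of voters with a given ranking is the product of
  these weights; the sum of the weights on \<open>B\<close> depends on \<open>card B\<close> only, so the total is
  \<open>\<Prod>h. h * z ^ (h - 1) - h * (h - 1) / 2\<close>. The distortion between two candidates of \<open>A\<close> caused by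
  the step from \<open>A\<close> has relative size \<open>z ^ - (card A - 1)\<close> and the right sign, whereas the distortions
  caused by larger sets are smaller by a factor \<open>z\<close>; hence the order on \<open>A\<close> is the one
  prescribed by \<open>\<sigma> A\<close>. For the second claim, copy this situation \<open>m!\<close> times: every
  difference of votes is then at least \<open>m!\<close>, and it survives adding the same number of voters to
  each ranking and fewer than \<open>m!\<close> voters to a single one.\<close>

section \<open>Rankings weighted by successive removal of the winner\<close>

text \<open>Generic in \<open>w\<close>: \<open>pattern_weight\<close> will give the situation
  sought, and the constant 1 gives one voter per ranking.\<close>

primrec list_weight :: "('a set \<Rightarrow> 'a \<Rightarrow> nat) \<Rightarrow> 'a set \<Rightarrow> 'a list \<Rightarrow> nat" where
  "list_weight w B [] = 1"
| "list_weight w B (x # xs) = w B x * list_weight w (B - {x}) xs"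

definition wins :: "'a list \<Rightarrow> 'a set \<Rightarrow> 'a \<Rightarrow> bool" where
  "wins js A i \<longleftrightarrow> (\<forall>j\<in>A - {i}. occurs_before js i j)"

definition total_weight :: "('a set \<Rightarrow> 'a \<Rightarrow> nat) \<Rightarrow> 'a set \<Rightarrow> nat" where
  "total_weight w B = (\<Sum>js\<in>permutations_of_set B. list_weight w B js)"

text \<open>The condition sits in the summand, so that \<open>sum_permutations_of_set\<close> can
  split the sum by the first candidate.\<close>

definition win_weight :: "('a set \<Rightarrow> 'a \<Rightarrow> nat) \<Rightarrow> 'a set \<Rightarrow> 'a set \<Rightarrow> 'a \<Rightarrow> nat" where
  "win_weight w B A i = (\<Sum>js\<in>permutations_of_set B. if wins js A i then list_weight w B js else 0)"

lemma votes_list_weight: "votes m (list_weight w {1..m}) A i = win_weight w {1..m} A i"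
  unfolding votes_def win_weight_def wins_def by (simp add: sum.If_cases Collect_conj_eq)

lemma num_voters_list_weight: "num_voters m (list_weight w {1..m}) = total_weight w {1..m}"
  unfolding num_voters_def total_weight_def ..

lemma occurs_before_imp_set:
  assumes "occurs_before xs i j"
  shows "j \<in> set xs"
  using assms unfolding occurs_before_def by auto

lemma occurs_before_Cons:
  "occurs_before (x # xs) i j \<longleftrightarrow> (i = x \<and> j \<in> set xs) \<or> occurs_before xs i j"
proof
  assume "occurs_before (x # xs) i j"
  then obtain a b where ab: "a < b" "b < Suc (length xs)" "(x # xs) ! a = i" "(x # xs) ! b = j"
    unfolding occurs_before_def by auto
  then obtain b' where b': "b = Suc b'" by (cases b) auto
  show "(i = x \<and> j \<in> set xs) \<or> occurs_before xs i j"
  proof (cases a)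
    case 0
    then show ?thesis using ab b' by auto
  next
    case (Suc a')
    then show ?thesis using ab b' unfolding occurs_before_def by auto
  qed
next
  assume "(i = x \<and> j \<in> set xs) \<or> occurs_before xs i j"
  then show "occurs_before (x # xs) i j"
  proof
    assume a: "i = x \<and> j \<in> set xs"
    then obtain b where "b < length xs" "xs ! b = j" by (auto simp: in_set_conv_nth)
    then show ?thesis using a unfolding occurs_before_def
      by (intro exI[of _ 0] exI[of _ "Suc b"]) auto
  next
    assume "occurs_before xs i j"
    then obtain a b where "a < b" "b < length xs" "xs ! a = i" "xs ! b = j"
      unfolding occurs_before_def by auto
    then show ?thesis unfolding occurs_before_def
      by (intro exI[of _ "Suc a"] exI[of _ "Suc b"]) auto
  qed
qed

text \<open>A first candidate in \<open>A\<close> precedes all its rivals and cannot recur in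
  \<open>xs\<close>, so it decides the contest; one outside \<open>A\<close> leaves it open.\<close>

lemma wins_Cons:
  assumes "xs \<in> permutations_of_set (B - {x})" "A \<subseteq> B" "i \<in> A"
  shows "wins (x # xs) A i \<longleftrightarrow> (if x \<in> A then x = i else wins xs A i)"
proof -
  have set: "set xs = B - {x}"
    using assms(1) by (auto dest: permutations_of_setD)
  then have "\<not> occurs_before xs j x" for j
    using occurs_before_imp_set[of xs j x] by auto
  then show ?thesis
    using assms set unfolding wins_def by (auto simp: occurs_before_Cons)
qed

lemma sum_permutations_of_set:
  assumes "finite B" "B \<noteq> {}"
  shows "(\<Sum>js\<in>permutations_of_set B. f js) =
    (\<Sum>x\<in>B. \<Sum>xs\<in>permutations_of_set (B - {x}). f (x # xs))"
proof -
  have "(\<Sum>js\<in>permutations_of_set B. f js) =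
      (\<Sum>x\<in>B. sum f ((#) x ` permutations_of_set (B - {x})))"
    unfolding permutations_of_set_nonempty[OF assms(2)] using assms(1)
    by (intro sum.UNION_disjoint) auto
  then show ?thesis by (simp add: sum.reindex)
qed

lemma total_weight_rec:
  assumes "finite B" "B \<noteq> {}"
  shows "total_weight w B = (\<Sum>x\<in>B. w B x * total_weight w (B - {x}))"
  unfolding total_weight_def sum_permutations_of_set[OF assms] by (simp add: sum_distrib_left)

text \<open>Split by the first candidate: \<open>i\<close> has won whatever follows, another member
  of \<open>A\<close> contributes nothing, and a candidate outside \<open>A\<close> defers the
  contest to a smaller set.\<close>

lemma win_weight_rec:
  assumes B: "finite B" and A: "A \<subseteq> B" and i: "i \<in> A"
  shows "win_weight w B A i =
    w B i * total_weight w (B - {i}) + (\<Sum>x\<in>B - A. w B x * win_weight w (B - {x}) A i)"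
proof -
  have ne: "B \<noteq> {}" using A i by auto
  have fA: "finite A" using A B finite_subset by blast
  have "win_weight w B A i = (\<Sum>x\<in>B. if x \<in> A then (if x = i then w B x * total_weight w (B - {x}) else 0)
      else w B x * win_weight w (B - {x}) A i)"
    unfolding win_weight_def sum_permutations_of_set[OF B ne] total_weight_def
    by (intro sum.cong refl)
      (auto simp: wins_Cons[OF _ A i] sum_distrib_left intro!: sum.cong sum.neutral)
  also have "\<dots> = (\<Sum>x\<in>A. if x = i then w B x * total_weight w (B - {x}) else 0)
      + (\<Sum>x\<in>B - A. w B x * win_weight w (B - {x}) A i)"
    unfolding sum.subset_diff[OF A B] by (simp add: add.commute)
  finally show ?thesis using i fA by simp
qed

text \<open>Every first choice leaves a set of the same size, hence by induction the same total,
  which factors out of the recursion.\<close>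

lemma total_weight_eq_prod:
  fixes f :: "nat \<Rightarrow> int"
  assumes "finite B"
    and "\<And>C. C \<subseteq> B \<Longrightarrow> card C \<ge> 2 \<Longrightarrow> int (\<Sum>x\<in>C. w C x) = f (card C)"
    and "\<And>x. x \<in> B \<Longrightarrow> w {x} x = 1"
  shows "int (total_weight w B) = (\<Prod>h=2..card B. f h)"
  using assms
proof (induction "card B" arbitrary: B)
  case 0
  then show ?case by (simp add: total_weight_def)
next
  case (Suc b)
  have ne: "B \<noteq> {}" using Suc.hyps(2) by auto
  have IH: "int (total_weight w (B - {x})) = (\<Prod>h=2..b. f h)" if "x \<in> B" for x
  proof -
    have "b = card (B - {x})" using that Suc.hyps(2) Suc.prems(1) by simp
    then show ?thesis using Suc.hyps(1)[of "B - {x}"] Suc.prems by auto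
  qed
  have "int (total_weight w B) = int (\<Sum>x\<in>B. w B x) * (\<Prod>h=2..b. f h)"
    unfolding total_weight_rec[OF Suc.prems(1) ne] by (simp add: IH sum_distrib_right)
  also have "\<dots> = (\<Prod>h=2..Suc b. f h)"
  \<comment> \<open>The product starts at 2, so a singleton has to contribute the factor 1.\<close>
  proof (cases "b = 0")
    case True
    then have "card B = 1" using Suc.hyps(2) by simp
    then obtain x where "B = {x}" by (rule card_1_singletonE)
    then have "w B x = 1" using Suc.prems(3) by simp
    then show ?thesis unfolding \<open>B = {x}\<close> True by simp
  next
    case False
    then have "int (\<Sum>x\<in>B. w B x) = f (Suc b)" using Suc.prems(2)[of B] Suc.hyps(2) by simp
    then show ?thesis using False by (simp add: prod.nat_ivl_Suc')
  qed
  finally show ?case using Suc.hyps(2) by simp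
qed

section \<open>One voter per ranking\<close>

text \<open>Shows that adding equally many voters to all rankings preserves differences of votes. In
  the recursion the totals depend on the size alone, and the other terms agree by induction.\<close>

lemma win_weight_const:
  assumes "finite B" "A \<subseteq> B" "i \<in> A" "j \<in> A"
  shows "win_weight (\<lambda>_ _. 1) B A i = win_weight (\<lambda>_ _. 1) B A j"
  using assms
proof (induction "card B" arbitrary: B rule: less_induct)
  case less
  have "int (total_weight (\<lambda>_ _. 1) (B - {x})) = (\<Prod>h=2..card B - 1. int h)" if "x \<in> A" for x
  proof -
    have "x \<in> B" using that less.prems by auto
    then have "card (B - {x}) = card B - 1" using less.prems(1) by simp
    then show ?thesis
      using total_weight_eq_prod[of "B - {x}" "\<lambda>_ _. 1" int] less.prems(1) by simp
  qed
  then have T: "total_weight (\<lambda>_ _. 1) (B - {i}) = total_weight (\<lambda>_ _. 1) (B - {j})"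
    using less.prems by (metis of_nat_eq_iff)
  have IH: "win_weight (\<lambda>_ _. 1) (B - {x}) A i = win_weight (\<lambda>_ _. 1) (B - {x}) A j"
    if "x \<in> B - A" for x
    using that less.prems by (intro less.hyps card_Diff1_less) auto
  show ?case
    unfolding win_weight_rec[OF less.prems(1,2,3)] win_weight_rec[OF less.prems(1,2,4)]
    using T IH by simp
qed

lemma list_weight_const: "list_weight (\<lambda>_ _. 1) B js = 1"
  by (induction js arbitrary: B) auto

lemma votes_const:
  assumes "A \<subseteq> {1..m}" "i \<in> A" "j \<in> A"
  shows "votes m (\<lambda>_. 1) A i = votes m (\<lambda>_. 1) A j"
proof -
  have "(\<lambda>_. 1) = list_weight (\<lambda>_ _. 1) {1..m}"
    by (rule ext) (rule list_weight_const[symmetric])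
  then show ?thesis
    using win_weight_const[OF _ assms] by (simp only: votes_list_weight finite_atLeastAtMost)
qed

section \<open>The weights attached to a ranking pattern\<close>

lemma strict_ranking_function_bij_betw:
  assumes "strict_ranking_function A f"
  shows "bij_betw f A {1..card A}"
proof -
  have inj: "inj_on f A" and "f ` A \<subseteq> {1..card A}"
    using assms by (auto simp: strict_ranking_function_def ranking_function_def)
  then have "f ` A = {1..card A}"
    by (intro card_subset_eq) (auto simp: card_image)
  then show ?thesis using inj by (simp add: bij_betw_def)
qed

text \<open>Each rank below the first costs one unit. The truncated subtraction is exact once
  \<open>2 \<le> card B \<le> z\<close>.\<close>

definition pattern_weight :: "nat \<Rightarrow> (nat set \<Rightarrow> nat \<Rightarrow> nat) \<Rightarrow> nat set \<Rightarrow> nat \<Rightarrow> nat" where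
  "pattern_weight z \<sigma> B i = (if card B \<le> 1 then 1 else z ^ (card B - 1) - (\<sigma> B i - 1))"

text \<open>The factor of index \<open>h\<close> in \<open>theta_bar\<close>, for general
  \<open>z\<close>.\<close>

definition level_weight :: "nat \<Rightarrow> nat \<Rightarrow> int" where
  "level_weight z h = int h * int z ^ (h - 1) - (int h * (int h - 1)) div 2"

lemma pattern_weight_eq:
  assumes \<sigma>: "strict_ranking_function B (\<sigma> B)" and "card B \<ge> 2" "card B \<le> z" "x \<in> B"
  shows "int (pattern_weight z \<sigma> B x) = int z ^ (card B - 1) - (int (\<sigma> B x) - 1)"
    and "1 \<le> \<sigma> B x" and "\<sigma> B x \<le> card B"
proof -
  show 1: "1 \<le> \<sigma> B x" and 2: "\<sigma> B x \<le> card B"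
    using strict_ranking_function_bij_betw[OF \<sigma>] assms(4) by (auto dest: bij_betwE)
  \<comment> \<open>The exponent is positive, so the power dominates \<open>z\<close>, hence every
    rank, and nothing is truncated.\<close>
  have "z \<le> z ^ (card B - 1)"
    using assms by (intro self_le_power) auto
  then have "\<sigma> B x - 1 \<le> z ^ (card B - 1)" using 2 assms by simp
  then show "int (pattern_weight z \<sigma> B x) = int z ^ (card B - 1) - (int (\<sigma> B x) - 1)"
    using 1 assms unfolding pattern_weight_def by (simp add: of_nat_diff)
qed

text \<open>Strictness makes the ranks run through \<open>{1..card B}\<close> once each, so their
  sum does not depend on the pattern.\<close>

lemma sum_pattern_weight:
  assumes \<sigma>: "strict_ranking_function B (\<sigma> B)" and B: "card B \<ge> 2" "card B \<le> z"
  shows "int (\<Sum>x\<in>B. pattern_weight z \<sigma> B x) = level_weight z (card B)"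
proof -
  have "(\<Sum>x\<in>B. int (\<sigma> B x) - 1) = (\<Sum>k=1..card B. int k - 1)"
    using strict_ranking_function_bij_betw[OF \<sigma>] by (rule sum.reindex_bij_betw)
  also have "\<dots> = (int (card B) * (int (card B) - 1)) div 2"
  proof -
    have "2 * (\<Sum>k=1..n. int k - 1) = int n * (int n - 1)" for n
      by (induction n) (auto simp: algebra_simps)
    from this[of "card B"] show ?thesis by linarith
  qed
  finally have "(\<Sum>x\<in>B. int (\<sigma> B x) - 1) = (int (card B) * (int (card B) - 1)) div 2" .
  moreover have "int (\<Sum>x\<in>B. pattern_weight z \<sigma> B x) =
      (\<Sum>x\<in>B. int z ^ (card B - 1) - (int (\<sigma> B x) - 1))"
    using pattern_weight_eq(1)[of B \<sigma> z] assms by simp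
  ultimately show ?thesis unfolding level_weight_def by (simp add: sum_subtractf[of "\<lambda>_. _"])
qed

lemma total_weight_pattern:
  assumes "\<sigma> \<in> strict_ranking_patterns m" "B \<subseteq> {1..m}" "m \<le> z"
  shows "int (total_weight (pattern_weight z \<sigma>) B) = (\<Prod>h=2..card B. level_weight z h)"
proof (rule total_weight_eq_prod)
  show fin: "finite B" using assms(2) finite_subset by blast
  fix C assume C: "C \<subseteq> B" "card C \<ge> 2"
  have "card C \<le> m" using card_mono[of "{1..m}" C] C assms(2) by auto
  then show "int (\<Sum>x\<in>C. pattern_weight z \<sigma> C x) = level_weight z (card C)"
    using C assms by (intro sum_pattern_weight) (auto simp: strict_ranking_patterns_def)
qed (simp add: pattern_weight_def)

section \<open>Size estimates and the main induction\<close>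

lemma level_weight_pos:
  assumes "2 \<le> h" "h \<le> z"
  shows "level_weight z h > 0"
proof -
  have "int z ^ 1 \<le> int z ^ (h - 1)"
    using assms by (intro power_increasing) auto
  moreover have "int h - 1 < int z ^ 1" using assms by simp
  ultimately have "int h - 1 < int z ^ (h - 1)" by linarith
  then have "int h * (int h - 1) < int h * int z ^ (h - 1)"
    using assms by (intro mult_strict_left_mono) auto
  moreover have "0 \<le> int h * (int h - 1)" using assms by simp
  then have "int h * (int h - 1) div 2 \<le> int h * (int h - 1)" by linarith
  ultimately show ?thesis unfolding level_weight_def by simp
qed

lemma real_level_weight:
  "real_of_int (level_weight z h) = real h * real z ^ (h - 1) - real h * (real h - 1) / 2"
proof -
  have "even (int h * (int h - 1))" by auto
  then show ?thesis unfolding level_weight_def by (simp add: real_of_int_div)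
qed

lemma le_17_mult_fact: "m \<le> 17 * m * fact m"
proof -
  have "m * 1 \<le> m * (17 * fact m)" by (intro mult_le_mono) (auto simp: Suc_le_eq)
  then show ?thesis by (simp only: ac_simps mult_1_right)
qed

text \<open>For \<open>h > 0\<close> the left side is \<open>b! / ((h - 1)! (b - h)!)\<close>. It
  multiplies the error in the induction, which is why \<open>z\<close> contains
  \<open>fact m\<close>.\<close>

lemma mult_binomial_le_fact:
  assumes "h \<le> b"
  shows "h * (b choose h) \<le> fact b"
proof (cases h)
  case (Suc k)
  have "(b choose h) * (fact h * fact (b - h)) = fact b"
    using binomial_fact_lemma[OF assms] by (simp add: ac_simps)
  then have "fact b = h * (b choose h) * (fact k * fact (b - h))"
    using Suc by (simp add: algebra_simps)
  moreover have "(1::nat) \<le> fact k * fact (b - h)" by (metis fact_ge_1 mult_le_mono nat_mult_1)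
  ultimately show ?thesis by (metis mult.right_neutral mult_le_mono2)
qed simp

text \<open>The induction below loses at most \<open>1 / (2 * m)\<close> of its constant \<open>c\<close> with each candidate
  added; this is where the size of \<open>z\<close> matters.\<close>

lemma level_weight_step:
  fixes c :: real
  assumes m: "2 \<le> h" "h < b" "b \<le> m" and z: "z = 17 * m * fact m" and c: "0 \<le> c" "c \<le> 1"
  shows "real_of_int (level_weight z b) * (c - 1 / (2 * real m)) \<le>
    real b * (real z ^ (b - 1) - (real b - 1)) * c
      - (real b - 1) * real (b choose h) * (real h * real z ^ (h - 1))"
proof -
  \<comment> \<open>The unit of measure is \<open>real b * (M * Y)\<close>. The two error terms cost
    at most one unit each, since \<open>h < b\<close> gives \<open>z ^ (h - 1) \<le> Y\<close>;
    lowering \<open>c\<close> by \<open>1 / (2 * m)\<close> frees at least eight.\<close>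
  define Y where "Y = real z ^ (b - 2)"
  define M where "M = (fact m :: real)"
  have M1: "M \<ge> real m" unfolding M_def using fact_ge_self[of m] by (metis of_nat_fact of_nat_le_iff)
  have mp: "real m \<ge> 3" "real b \<le> real m" "real b \<ge> 3" using m by auto
  have zr: "real z = 17 * real m * M" unfolding z M_def by simp
  have "real z \<ge> 1" using M1 mp mult_mono[of 1 "17 * real m" 1 M] by (simp add: zr)
  then have Y1: "Y \<ge> 1" and hY: "real z ^ (h - 1) \<le> Y"
    unfolding Y_def using m by (auto intro: one_le_power power_increasing)
  have zY: "real z ^ (b - 1) = 17 * real m * M * Y"
  proof -
    have "b - 1 = Suc (b - 2)" using m by simp
    then show ?thesis unfolding Y_def zr[symmetric] by simp
  qed
  have "real (h * (b choose h)) \<le> M"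
    using mult_binomial_le_fact[of h b] fact_mono_nat[of b m] m unfolding M_def
    by (metis less_imp_le_nat of_nat_fact of_nat_le_iff order_trans)
  then have CK: "real (b choose h) * (real h * real z ^ (h - 1)) \<le> M * Y"
    using mult_mono[of "real (h * (b choose h))" M "real z ^ (h - 1)" Y] hY M1 mp
    by (simp add: ac_simps)
  have "(real b - 1) * real (b choose h) * (real h * real z ^ (h - 1)) \<le> real b * (M * Y)"
    using mult_mono[OF _ CK, of "real b - 1" "real b"] Y1 M1 mp by (simp add: ac_simps)
  moreover have "real b * (real b - 1) / 2 * c \<le> real b * (real b - 1) / 2"
    using c mp by (simp add: mult_left_le)
  moreover have "real b * (real b - 1) / 2 \<le> real b * (M * Y)"
  proof -
    have "(real b - 1) / 2 \<le> M * 1" using mp M1 by simp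
    also have "\<dots> \<le> M * Y" using Y1 M1 mp by (intro mult_left_mono) auto
    finally have "(real b - 1) / 2 \<le> M * Y" .
    from mult_left_mono[OF this, of "real b"] show ?thesis by simp
  qed
  \<comment> \<open>Here the 17 enters: the leading term is \<open>17 * m\<close> units, the
    subtracted \<open>b * (b - 1) / 2\<close> is at most \<open>m\<close> units, and
    \<open>16 * m\<close> divided by \<open>2 * m\<close> is eight.\<close>
  moreover have "real_of_int (level_weight z b) / (2 * real m) \<ge> 8 * real b * (M * Y)"
  proof -
    have "(real b - 1) / 2 \<le> real m * (M * Y)"
    proof -
      have "1 \<le> M * Y" using mp M1 Y1 mult_mono[of 1 M 1 Y] by simp
      then have "real m \<le> real m * (M * Y)" using mult_left_mono[of 1 "M * Y" "real m"] by simp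
      moreover have "(real b - 1) / 2 \<le> real m" using mp by simp
      ultimately show ?thesis by (rule order_trans[rotated])
    qed
    from mult_left_mono[OF this, of "real b"]
    have "real b * (real b - 1) / 2 \<le> real b * (real m * (M * Y))" by simp
    then have "real_of_int (level_weight z b) \<ge> 16 * real b * (real m * (M * Y))"
      unfolding real_level_weight zY by (simp add: algebra_simps)
    then show ?thesis using mp by (simp add: field_simps)
  qed
  moreover have "0 \<le> real b * (M * Y)" using mp M1 Y1 by simp
  moreover have "real_of_int (level_weight z b) * c =
      real b * (real z ^ (b - 1) - (real b - 1)) * c + real b * (real b - 1) / 2 * c"
    unfolding real_level_weight by (simp add: field_simps)
  moreover have "real_of_int (level_weight z b) * (c - 1 / (2 * real m)) =
      real_of_int (level_weight z b) * c - real_of_int (level_weight z b) / (2 * real m)"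
    by (simp add: right_diff_distrib)
  ultimately show ?thesis by linarith
qed

text \<open>The ratio of the difference of the winning weights to the total weight is multiplied by
  about \<open>(b - h) / b\<close> when a candidate outside \<open>A\<close> is added, which the binomial coefficient
  compensates.\<close>

lemma win_weight_diff:
  assumes \<sigma>: "\<sigma> \<in> strict_ranking_patterns m" and z: "z = 17 * m * fact m"
    and A: "card A \<ge> 2" "i \<in> A" "j \<in> A" "\<sigma> A i < \<sigma> A j"
    and B: "A \<subseteq> B" "B \<subseteq> {1..m}"
  defines "w \<equiv> pattern_weight z \<sigma>"
  shows "real (total_weight w B) * (1 - (real (card B) - real (card A)) / (2 * real m)) \<le>
    real (card B choose card A) * (real (card A) * real z ^ (card A - 1))
      * (real (win_weight w B A i) - real (win_weight w B A j))"
  using B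
proof (induction "card B" arbitrary: B rule: less_induct)
  case less
  define h where "h = card A"
  define b where "b = card B"
  define K where "K = real h * real z ^ (h - 1)"
  define D where "D = (\<lambda>C. real (win_weight w C A i) - real (win_weight w C A j))"
  \<comment> \<open>\<open>t\<close> is the common total weight of all sets \<open>B - {x}\<close>,
    and \<open>c\<close> the constant that the induction hypothesis supplies for them.\<close>
  define t where "t = real_of_int (\<Prod>h=2..b - 1. level_weight z h)"
  define c where "c = 1 - (real b - 1 - real h) / (2 * real m)"
  have fB: "finite B" using less.prems finite_subset by blast
  have iB: "i \<in> B" and jB: "j \<in> B" using A less.prems by auto
  have hb: "h \<le> b" "b \<le> m" "2 \<le> h"
    using less.prems fB A card_mono[of B A] card_mono[of "{1..m}" B] by (auto simp: h_def b_def)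
  have mz: "m \<le> z" unfolding z by (rule le_17_mult_fact)
  have bz: "card B \<ge> 2" "card B \<le> z" using hb mz by (auto simp: b_def)
  have z1: "real z \<ge> 1" using hb mz by simp
  have Kpos: "K > 0" unfolding K_def using hb z1 by simp
  have tpos: "t > 0"
  proof -
    have "0 < (\<Prod>h=2..b - 1. level_weight z h)"
      using hb mz by (intro prod_pos) (auto intro!: level_weight_pos)
    then show ?thesis unfolding t_def by (simp only: of_int_0_less_iff)
  qed
  have T1: "real (total_weight w (B - {x})) = t" if "x \<in> B" for x
  proof -
    have "int (total_weight w (B - {x})) = (\<Prod>h=2..b - 1. level_weight z h)"
      using total_weight_pattern[OF \<sigma> _ mz, of "B - {x}"] that less.prems fB
      by (auto simp: w_def b_def)
    then show ?thesis unfolding t_def by (metis of_int_of_nat_eq)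
  qed
  have T: "real (total_weight w B) = real_of_int (level_weight z b) * t"
  proof -
    have "int (total_weight w B) = (\<Prod>h=2..b. level_weight z h)"
      using total_weight_pattern[OF \<sigma> _ mz, of B] less.prems by (auto simp: w_def b_def)
    also have "\<dots> = level_weight z b * (\<Prod>h=2..b - 1. level_weight z h)"
      using hb by (cases b) (auto simp: prod.nat_ivl_Suc')
    finally show ?thesis unfolding t_def by (metis of_int_mult of_int_of_nat_eq)
  qed
  have sB: "strict_ranking_function B (\<sigma> B)"
    using \<sigma> less.prems hb by (auto simp: strict_ranking_patterns_def b_def)
  have weq: "real (w B x) = real z ^ (b - 1) - (real (\<sigma> B x) - 1)" if "x \<in> B" for x
  proof -
    have "real_of_int (int (w B x)) = real_of_int (int z ^ (b - 1) - (int (\<sigma> B x) - 1))"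
      using pattern_weight_eq(1)[of B \<sigma> z x] sB bz that by (simp add: w_def b_def)
    then show ?thesis by simp
  qed
  have srange: "1 \<le> real (\<sigma> B x)" "real (\<sigma> B x) \<le> real b" if "x \<in> B" for x
    using pattern_weight_eq(2,3)[of B \<sigma> z x] sB bz that by (auto simp: b_def)
  \<comment> \<open>The weights of \<open>i\<close> and \<open>j\<close> on \<open>B\<close> share
    the power of \<open>z\<close>, which cancels; only the difference of ranks remains.\<close>
  have rec: "D B = (real (\<sigma> B j) - real (\<sigma> B i)) * t + (\<Sum>x\<in>B - A. real (w B x) * D (B - {x}))"
    unfolding D_def win_weight_rec[OF fB less.prems(1) A(2)] win_weight_rec[OF fB less.prems(1) A(3)]
    by (simp add: T1 iB jB weq sum_subtractf right_diff_distrib) (simp add: algebra_simps)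
  have "real_of_int (level_weight z b) * t * (1 - (real b - real h) / (2 * real m))
      \<le> real (b choose h) * K * D B"
  proof (cases "B = A")
    \<comment> \<open>Base case: nothing lies outside \<open>A\<close>, and the ranks differ by at
      least one in the right direction.\<close>
    case True
    then have "b = h" by (simp add: b_def h_def)
    have "real_of_int (level_weight z b) \<le> K"
      unfolding K_def real_level_weight \<open>b = h\<close> using hb by simp
    then have "real_of_int (level_weight z b) * t \<le> K * t"
      using tpos by simp
    also have "\<dots> \<le> K * D B"
    proof -
      have "1 * t \<le> (real (\<sigma> B j) - real (\<sigma> B i)) * t"
        using A(4) True tpos by (intro mult_right_mono) auto
      then show ?thesis using Kpos rec True by simp
    qed
    finally show ?thesis using \<open>b = h\<close> by simp
  next
    case False
    then have hb': "h < b" using less.prems fB by (simp add: b_def h_def psubset_card_mono psubsetI)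
    have ch: "real (b - 1 choose h) > 0" using hb' by simp
    have c: "0 \<le> c" "c \<le> 1" unfolding c_def using hb hb' by (auto simp: field_simps)
    have low: "0 \<le> real z ^ (b - 1) - (real b - 1)"
    proof -
      have "real z ^ 1 \<le> real z ^ (b - 1)" using z1 hb' hb by (intro power_increasing) auto
      moreover have "real b - 1 \<le> real z ^ 1" using hb mz by simp
      ultimately show ?thesis by linarith
    qed
    \<comment> \<open>The induction hypothesis solved for the difference of votes: one lower bound
      valid for every \<open>x\<close> outside \<open>A\<close>.\<close>
    define d where "d = t * c / (real (b - 1 choose h) * K)"
    have d0: "d \<ge> 0" unfolding d_def using tpos c Kpos by simp
    have IH: "d \<le> D (B - {x})" if x: "x \<in> B - A" for x
    proof -
      have "card (B - {x}) < card B" using x fB by (intro card_Diff1_less) auto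
      moreover have "card (B - {x}) = b - 1" using x fB by (simp add: b_def)
      moreover have "real (b - 1) = real b - 1" using hb by simp
      ultimately have "t * c \<le> real (b - 1 choose h) * K * D (B - {x})"
        using less.hyps[of "B - {x}"] x less.prems T1[of x]
        by (auto simp: h_def[symmetric] K_def D_def c_def)
      then show ?thesis unfolding d_def using Kpos ch by (simp add: field_simps)
    qed
    have card: "real (card (B - A)) = real b - real h"
      using less.prems fB hb by (simp add: card_Diff_subset finite_subset b_def h_def of_nat_diff)
    have "(real b - real h) * ((real z ^ (b - 1) - (real b - 1)) * d)
        = (\<Sum>x\<in>B - A. (real z ^ (b - 1) - (real b - 1)) * d)"
      using card by simp
    also have "\<dots> \<le> (\<Sum>x\<in>B - A. real (w B x) * D (B - {x}))"
    proof (rule sum_mono)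
      fix x assume x: "x \<in> B - A"
      then have "real z ^ (b - 1) - (real b - 1) \<le> real (w B x)"
        using weq[of x] srange[of x] by auto
      then show "(real z ^ (b - 1) - (real b - 1)) * d \<le> real (w B x) * D (B - {x})"
        using IH[OF x] low d0 by (intro mult_mono) auto
    qed
    finally have S: "(real b - real h) * ((real z ^ (b - 1) - (real b - 1)) * d)
        \<le> (\<Sum>x\<in>B - A. real (w B x) * D (B - {x}))" .
    \<comment> \<open>On \<open>B\<close> the pattern may reverse \<open>i\<close> and
      \<open>j\<close>, but ranks differ by at most \<open>b - 1\<close>.\<close>
    have "(real (\<sigma> B j) - real (\<sigma> B i)) * t \<ge> (- (real b - 1)) * t"
      using tpos srange[OF iB] srange[OF jB] by (intro mult_right_mono) auto
    then have DB: "(real b - real h) * ((real z ^ (b - 1) - (real b - 1)) * d) - (real b - 1) * t \<le> D B"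
      using rec S unfolding mult_minus_left by linarith
    \<comment> \<open>The \<open>b - h\<close> possible first candidates outside \<open>A\<close>
      are absorbed into the binomial coefficient, producing the factor \<open>b\<close> of the
      leading term of \<open>level_weight z b\<close>.\<close>
    have choose: "real (b choose h) * (real b - real h) = real b * real (b - 1 choose h)"
    proof -
      have "(b - h) * (b choose h) = b * (b - 1 choose h)"
        using binomial_absorb_comp[of b h] by simp
      then have "real ((b - h) * (b choose h)) = real (b * (b - 1 choose h))" by (rule arg_cong)
      then show ?thesis using hb by (simp add: of_nat_diff mult.commute)
    qed
    have dK: "real (b - 1 choose h) * K * d = t * c"
      unfolding d_def using Kpos ch by simp
    have "1 - (real b - real h) / (2 * real m) = c - 1 / (2 * real m)"
      unfolding c_def by (simp add: diff_divide_distrib)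
    then have "real_of_int (level_weight z b) * t * (1 - (real b - real h) / (2 * real m))
        = real_of_int (level_weight z b) * (c - 1 / (2 * real m)) * t"
      by simp
    also have "\<dots> \<le> (real b * (real z ^ (b - 1) - (real b - 1)) * c
        - (real b - 1) * real (b choose h) * K) * t"
      using level_weight_step[OF _ hb' _ z c] hb tpos unfolding K_def by (intro mult_right_mono) auto
    also have "\<dots> = real b * (real z ^ (b - 1) - (real b - 1)) * (t * c)
        - (real b - 1) * real (b choose h) * K * t"
      by (simp add: algebra_simps)
    also have "\<dots> = (real (b choose h) * (real b - real h)) * (real z ^ (b - 1) - (real b - 1)) * (K * d)
        - (real b - 1) * real (b choose h) * K * t"
      unfolding dK[symmetric] choose by (simp add: ac_simps)
    also have "\<dots> = real (b choose h) * K * ((real b - real h) * ((real z ^ (b - 1) - (real b - 1)) * d)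
        - (real b - 1) * t)"
      by (simp add: algebra_simps)
    also have "\<dots> \<le> real (b choose h) * K * D B"
      using DB Kpos by (intro mult_left_mono) auto
    finally show ?thesis .
  qed
  then show ?case unfolding T[symmetric] by (simp add: b_def h_def K_def D_def)
qed

section \<open>Voting situations for the two claims\<close>

lemma exists_strict_voting_situation:
  assumes m: "m \<ge> 2" and \<sigma>: "\<sigma> \<in> strict_ranking_patterns m"
  obtains N where "int (num_voters m N) = theta_bar m"
    and "\<And>A i j. A \<subseteq> {1..m} \<Longrightarrow> i \<in> A \<Longrightarrow> j \<in> A \<Longrightarrow> card A \<ge> 2 \<Longrightarrow> \<sigma> A i < \<sigma> A j \<Longrightarrow>
      votes m N A j < votes m N A i"
proof -
  define z where "z = 17 * m * fact m"
  define w where "w = pattern_weight z \<sigma>"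
  have mz: "m \<le> z" unfolding z_def by (rule le_17_mult_fact)
  have T: "int (total_weight w {1..m}) = (\<Prod>h=2..m. level_weight z h)"
    using total_weight_pattern[OF \<sigma> subset_refl mz] by (simp add: w_def)
  have pos: "0 < total_weight w {1..m}"
  proof -
    have "0 < (\<Prod>h=2..m. level_weight z h)"
      using mz by (intro prod_pos) (auto intro!: level_weight_pos)
    then show ?thesis using T by simp
  qed
  show thesis
  proof
    show "int (num_voters m (list_weight w {1..m})) = theta_bar m"
      unfolding num_voters_list_weight T theta_bar_def level_weight_def z_num_def z_def by simp
    fix A i j
    assume A: "A \<subseteq> {1..m}" "i \<in> A" "j \<in> A" "card A \<ge> 2" "\<sigma> A i < \<sigma> A j"
    \<comment> \<open>At most \<open>m - 2\<close> candidates were added at a cost of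
      \<open>1 / (2 * m)\<close> each, so more than half of the constant survives.\<close>
    have "0 < 1 - (real m - real (card A)) / (2 * real m)" using m by (simp add: field_simps)
    then have "0 < real (total_weight w {1..m}) * (1 - (real m - real (card A)) / (2 * real m))"
      using pos by simp
    also have "\<dots> \<le> real (m choose card A) * (real (card A) * real z ^ (card A - 1))
      * (real (win_weight w {1..m} A i) - real (win_weight w {1..m} A j))"
      using win_weight_diff[OF \<sigma> z_def A(4,2,3,5,1) subset_refl] by (simp add: w_def)
    finally show "votes m (list_weight w {1..m}) A j < votes m (list_weight w {1..m}) A i"
      unfolding votes_list_weight
      by (metis diff_gt_0_iff_gt mult_nonneg_nonneg of_nat_0_le_iff of_nat_less_iff
          zero_le_power zero_less_mult_pos less_le_not_le mult_nonneg_nonpos not_le)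
  qed
qed

text \<open>Strict ranks of distinct candidates never tie, so applying the one-sided implication to
  both orders of the pair settles both equivalences.\<close>

lemma q_concordantI:
  assumes "\<sigma> \<in> strict_ranking_patterns m"
    and less: "\<And>A i j. A \<subseteq> {1..m} \<Longrightarrow> i \<in> A \<Longrightarrow> j \<in> A \<Longrightarrow> card A \<ge> 2 \<Longrightarrow> \<sigma> A i < \<sigma> A j \<Longrightarrow>
      votes m N A j < votes m N A i"
  shows "q_concordant m \<sigma> N"
  unfolding q_concordant_def
proof (intro allI impI, elim conjE)
  fix A i j assume A: "A \<subseteq> {1..m}" "i \<in> A" "j \<in> A" "i \<noteq> j"
  have "finite A" using A finite_subset by blast
  then have card: "card A \<ge> 2" using A card_mono[of A "{i, j}"] by simp
  then have "\<sigma> A i \<noteq> \<sigma> A j"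
    using A assms(1) by (auto simp: strict_ranking_patterns_def strict_ranking_function_def dest: inj_onD)
  then show "(\<sigma> A i < \<sigma> A j) = (votes m N A j < votes m N A i) \<and>
      (\<sigma> A i = \<sigma> A j) = (votes m N A i = votes m N A j)"
    using less[of A i j] less[of A j i] A card by (metis less_asym linorder_neqE_nat nat_neq_iff)
qed

theorem theorem4:
  fixes m :: nat
  assumes "m \<ge> 2"
  shows "theta_bar m \<in> Theta_hat m
    \<and> (\<forall>\<theta>::int. \<theta> \<ge> theta_bar m * fact m \<longrightarrow> \<theta> \<in> Theta_hat m)"
proof (intro conjI allI impI)
  have "theta_bar m = (\<Prod>h=2..m. level_weight (17 * m * fact m) h)"
    unfolding theta_bar_def level_weight_def z_num_def by simp
  also have "\<dots> > 0"
  proof (intro prod_pos level_weight_pos)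
    fix h assume "h \<in> {2..m}"
    then show "2 \<le> h" "h \<le> 17 * m * fact m"
      using order_trans[OF _ le_17_mult_fact[of m]] by auto
  qed
  finally have pos: "theta_bar m \<ge> 1" by simp
  show "theta_bar m \<in> Theta_hat m"
    unfolding Theta_hat_def
  proof (intro CollectI conjI ballI pos)
    fix \<sigma> assume \<sigma>: "\<sigma> \<in> strict_ranking_patterns m"
    obtain N where N: "int (num_voters m N) = theta_bar m"
      "\<And>A i j. A \<subseteq> {1..m} \<Longrightarrow> i \<in> A \<Longrightarrow> j \<in> A \<Longrightarrow> card A \<ge> 2 \<Longrightarrow> \<sigma> A i < \<sigma> A j \<Longrightarrow>
        votes m N A j < votes m N A i"
      using exists_strict_voting_situation[OF assms \<sigma>] by blast
    then show "\<exists>N. voting_situation m N \<and> q_concordant m \<sigma> N \<and> int (num_voters m N) = theta_bar m"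
      using q_concordantI[OF \<sigma> N(2)] pos by (intro exI[of _ N]) (auto simp: voting_situation_def)
  qed
  fix \<theta> :: int assume \<theta>: "\<theta> \<ge> theta_bar m * fact m"
  have "1 * 1 \<le> theta_bar m * fact m"
    using pos by (intro mult_mono) auto
  then have \<theta>1: "\<theta> \<ge> 1" using \<theta> by simp
  \<comment> \<open>The excess over \<open>fact m\<close> copies is divided into \<open>c\<close>
    rounds of one voter for each of the \<open>fact m\<close> rankings and a remainder
    \<open>r\<close>.\<close>
  define e where "e = nat (\<theta> - theta_bar m * fact m)"
  define c where "c = e div fact m"
  define r where "r = e mod fact m"
  have r: "r < fact m" unfolding r_def by simp
  have e: "e = c * fact m + r" unfolding c_def r_def by simp
  have e': "\<theta> = theta_bar m * fact m + (int c * fact m + int r)"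
    using arg_cong[OF e, of int] \<theta> unfolding e_def by simp
  define P where "P = permutations_of_set {1..m}"
  have "P \<noteq> {}" and finP: "finite P" unfolding P_def by auto
  then obtain js0 where js0: "js0 \<in> P" by auto
  show "\<theta> \<in> Theta_hat m"
    unfolding Theta_hat_def
  proof (intro CollectI conjI ballI \<theta>1)
    fix \<sigma> assume \<sigma>: "\<sigma> \<in> strict_ranking_patterns m"
    obtain N where N: "int (num_voters m N) = theta_bar m"
      "\<And>A i j. A \<subseteq> {1..m} \<Longrightarrow> i \<in> A \<Longrightarrow> j \<in> A \<Longrightarrow> card A \<ge> 2 \<Longrightarrow> \<sigma> A i < \<sigma> A j \<Longrightarrow>
        votes m N A j < votes m N A i"
      using exists_strict_voting_situation[OF assms \<sigma>] by blast
    \<comment> \<open>The arbitrary ranking \<open>js0\<close> takes the remainder, which shifts any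
      vote count by at most \<open>r < fact m\<close>.\<close>
    define N' where "N' = (\<lambda>js. fact m * N js + c * 1 + (if js = js0 then r else 0))"
    have "num_voters m N' = fact m * num_voters m N + c * fact m + r"
      using js0 finP unfolding num_voters_def N'_def P_def[symmetric]
      by (simp add: sum.distrib sum_distrib_left) (simp add: P_def)
    then have total: "int (num_voters m N') = \<theta>"
      using N(1) e' by (simp add: algebra_simps)
    have votes': "votes m N' A i = fact m * votes m N A i + c * votes m (\<lambda>_. 1) A i +
        votes m (\<lambda>js. if js = js0 then r else 0) A i" for A i
      unfolding votes_def N'_def by (simp add: sum.distrib sum_distrib_left)
    have extra: "votes m (\<lambda>js. if js = js0 then r else 0) A i \<le> r" for A i
      unfolding votes_def by (simp add: sum.delta)
    have "q_concordant m \<sigma> N'"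
    proof (rule q_concordantI[OF \<sigma>])
      fix A i j
      assume A: "A \<subseteq> {1..m}" "i \<in> A" "j \<in> A" "card A \<ge> 2" "\<sigma> A i < \<sigma> A j"
      have "votes m N A j + 1 \<le> votes m N A i" using N(2)[OF A] by simp
      then have "fact m * (votes m N A j + 1) \<le> fact m * votes m N A i"
        by (intro mult_le_mono) auto
      then show "votes m N' A j < votes m N' A i"
        using extra[of A j] r votes_const[OF A(1,2,3)] unfolding votes' by simp
    qed
    then show "\<exists>N. voting_situation m N \<and> q_concordant m \<sigma> N \<and> int (num_voters m N) = \<theta>"
      using total \<theta>1 by (intro exI[of _ N']) (auto simp: voting_situation_def)
  qed
qed

end
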